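(* Let $M$ be a manifold with a one-dimensional foliation. Then every long semi-leaf of the foliation is properly embedded in $M$, i.e. its leaf topology coincides with the relative topology induced from $M$.
   Context: A manifold is a connected Hausdorff topological manifold without boundary, NOT assumed metrizable or second countable. A one-dimensional foliation is a $C^0$ foliation locally modelled on the partition of $\mathbb R^n$ into parallel lines. Given a point $p\in M$ and one of the two directions along the leaf through $p$, the semi-leaf emanating from $p$ in that direction is the part of the leaf swept out by moving from $p$ in that direction; with the leaf topology it is a $1$-manifold with boundary. A semi-leaf is long if it is non-metrizable in the leaf topology, in which case it is homeomorphic to the closed long ray $\mathbb L_{\ge 0}=\omega_1\times[0,1)$ (lexicographic order topology). "Properly embedded" here means that the leaf topology matches the relative topology. *)

theory Defs
  imports "HOL-Analysis.Analysis"
begin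

text \<open>Spaces are abstract topologies, \<^term>\<open>Euclidean_space n\<close> is the library's \<open>n\<close>-space of
  sequences vanishing from index \<open>n\<close> on, so that the dimension \<open>n\<close> is an ordinary natural number.
  Neither metrizability nor second countability is part of the notion of manifold.\<close>

definition chart_on :: "nat \<Rightarrow> 'a topology \<Rightarrow> 'a set \<Rightarrow> ('a \<Rightarrow> nat \<Rightarrow> real) \<Rightarrow> bool" where
  "chart_on n M U \<phi> \<longleftrightarrow>
     openin M U \<and>
     (\<exists>V. openin (Euclidean_space n) V \<and>
          homeomorphic_map (subtopology M U) (subtopology (Euclidean_space n) V) \<phi>)"

definition manifold :: "nat \<Rightarrow> 'a topology \<Rightarrow> bool" where
  "manifold n M \<longleftrightarrow>
     connected_space M \<and> Hausdorff_space M \<and>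
     (\<forall>p\<in>topspace M. \<exists>U \<phi>. p \<in> U \<and> chart_on n M U \<phi>)"

text \<open>The model foliation of \<open>n\<close>-space is by the lines parallel to the axis of coordinate \<open>0\<close>.
  Two points lie on the same line iff their transverse coordinates agree.\<close>

definition transverse :: "(nat \<Rightarrow> real) \<Rightarrow> nat \<Rightarrow> real" where
  "transverse x = (\<lambda>i. x (Suc i))"

text \<open>A one-dimensional \<open>C\<^sup>0\<close> foliation is given by a foliated atlas: near every point of an overlap
  the change of charts has the form \<open>(x, y) \<mapsto> (h\<^sub>1(x, y), h\<^sub>2(y))\<close>, where \<open>y\<close> is the transverse
  coordinate. Continuity of \<open>h\<^sub>2\<close> (after shrinking \<open>W\<close>) follows from that of the charts. The atlas is
  not required to be maximal: it determines the same leaves and leaf topology as the maximal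
  foliated atlas containing it.\<close>

definition one_dim_foliation ::
  "nat \<Rightarrow> 'a topology \<Rightarrow> ('a set \<times> ('a \<Rightarrow> nat \<Rightarrow> real)) set \<Rightarrow> bool" where
  "one_dim_foliation n M \<A> \<longleftrightarrow>
     1 \<le> n \<and>
     (\<forall>(U, \<phi>)\<in>\<A>. chart_on n M U \<phi>) \<and>
     (\<forall>p\<in>topspace M. \<exists>(U, \<phi>)\<in>\<A>. p \<in> U) \<and>
     (\<forall>(U, \<phi>)\<in>\<A>. \<forall>(V, \<psi>)\<in>\<A>. \<forall>p\<in>U \<inter> V.
        \<exists>W h. openin M W \<and> p \<in> W \<and> W \<subseteq> U \<inter> V \<and>
              (\<forall>q\<in>W. transverse (\<psi> q) = h (transverse (\<phi> q))))"

text \<open>The leaf topology, on the whole of \<open>M\<close>: its open sets are generated by the intersections of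
  open subsets of \<open>M\<close> lying in a chart domain with the slices of that chart. The leaf topology of
  an individual leaf, or of a semi-leaf, is the subspace topology inherited from it.\<close>

definition leaf_topology ::
  "'a topology \<Rightarrow> ('a set \<times> ('a \<Rightarrow> nat \<Rightarrow> real)) set \<Rightarrow> 'a topology" where
  "leaf_topology M \<A> = topology_generated_by
     {{q \<in> O'. transverse (\<phi> q) = c} |O' U \<phi> c. (U, \<phi>) \<in> \<A> \<and> openin M O' \<and> O' \<subseteq> U}"

definition leaf ::
  "'a topology \<Rightarrow> ('a set \<times> ('a \<Rightarrow> nat \<Rightarrow> real)) set \<Rightarrow> 'a \<Rightarrow> 'a set" where
  "leaf M \<A> p = connected_component_of_set (leaf_topology M \<A>) p"

text \<open>The two directions along the leaf through \<open>p\<close> are encoded by a foliated chart \<open>(U, \<phi>)\<close> around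
  \<open>p\<close> and a sign \<open>d\<close>: the points of the leaf near \<open>p\<close> lying in direction \<open>d\<close> are those whose
  coordinate \<open>0\<close> is larger (\<open>d = 1\<close>) or smaller (\<open>d = -1\<close>) than that of \<open>p\<close>.
  The semi-leaf is swept out by the injective paths in the leaf which leave \<open>p\<close> in that direction.
  It contains \<open>p\<close>; if the leaf is a circle then it is the whole leaf.\<close>

definition starts_in_direction ::
  "'a set \<Rightarrow> ('a \<Rightarrow> nat \<Rightarrow> real) \<Rightarrow> real \<Rightarrow> (real \<Rightarrow> 'a) \<Rightarrow> bool" where
  "starts_in_direction U \<phi> d \<gamma> \<longleftrightarrow>
     (\<exists>\<epsilon>. 0 < \<epsilon> \<and> \<epsilon> \<le> 1 \<and>
        (\<forall>t. 0 < t \<and> t < \<epsilon> \<longrightarrow> \<gamma> t \<in> U \<and> d * (\<phi> (\<gamma> t) 0 - \<phi> (\<gamma> 0) 0) > 0))"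

definition semi_leaf ::
  "'a topology \<Rightarrow> ('a set \<times> ('a \<Rightarrow> nat \<Rightarrow> real)) set \<Rightarrow> 'a \<Rightarrow> 'a set \<Rightarrow> ('a \<Rightarrow> nat \<Rightarrow> real) \<Rightarrow> real \<Rightarrow> 'a set"
  where
  "semi_leaf M \<A> p U \<phi> d = insert p
     {q. \<exists>\<gamma>. pathin (subtopology (leaf_topology M \<A>) (leaf M \<A> p)) \<gamma> \<and> inj_on \<gamma> {0..1} \<and>
             \<gamma> 0 = p \<and> \<gamma> 1 = q \<and> starts_in_direction U \<phi> d \<gamma>}"

definition is_semi_leaf ::
  "'a topology \<Rightarrow> ('a set \<times> ('a \<Rightarrow> nat \<Rightarrow> real)) set \<Rightarrow> 'a set \<Rightarrow> bool" where
  "is_semi_leaf M \<A> S \<longleftrightarrow>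
     (\<exists>p U \<phi> d. (U, \<phi>) \<in> \<A> \<and> p \<in> U \<and> d \<in> {1, -1} \<and> S = semi_leaf M \<A> p U \<phi> d)"

definition long_semi_leaf ::
  "'a topology \<Rightarrow> ('a set \<times> ('a \<Rightarrow> nat \<Rightarrow> real)) set \<Rightarrow> 'a set \<Rightarrow> bool" where
  "long_semi_leaf M \<A> S \<longleftrightarrow>
     is_semi_leaf M \<A> S \<and> \<not> metrizable_space (subtopology (leaf_topology M \<A>) S)"

definition properly_embedded_in ::
  "'a topology \<Rightarrow> ('a set \<times> ('a \<Rightarrow> nat \<Rightarrow> real)) set \<Rightarrow> 'a set \<Rightarrow> bool" where
  "properly_embedded_in M \<A> S \<longleftrightarrow> subtopology (leaf_topology M \<A>) S = subtopology M S"

end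

theory Submission
  imports Defs
begin

text \<open>The leaf topology \<open>L\<close> is Hausdorff, regular, locally second countable and finer than the
  topology of \<open>M\<close>. A semi-leaf is a union of arcs with a common starting point and direction, and if
  the endpoint of one such arc does not lie on another one, then it contains that other one. Countably
  many of these arcs have a metrizable union by Urysohn's metrization theorem, so they do not cover a
  long semi-leaf; an arc to a point that they miss contains all of them. Thus every countable subset
  of a long semi-leaf lies in an \<open>L\<close>-compact arc, on which the two topologies agree, and since \<open>M\<close> is
  first countable, this determines the relative topology.\<close>

subsection \<open>Metrizability and comparison of topologies\<close>

text \<open>Urysohn's metrization theorem. Countably many real functions, one for each pair of basic
  open sets with the closure of the first inside the second, separate points from closed sets.
  Together they embed \<open>X\<close> into a countable power of the real line, which is
  metrizable.\<close>

theorem regular_second_countable_imp_metrizable_space: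
  assumes "regular_space X" "Hausdorff_space X" "second_countable X"
  shows "metrizable_space X"
proof -
  obtain B where B: "countable B" "\<And>V. V \<in> B \<Longrightarrow> openin X V"
    and base: "\<And>U x. openin X U \<Longrightarrow> x \<in> U \<Longrightarrow> \<exists>V\<in>B. x \<in> V \<and> V \<subseteq> U"
    using assms(3) unfolding second_countable_def by metis
  have normal: "normal_space X"
    using assms by (simp add: regular_Lindelof_imp_normal_space second_countable_imp_Lindelof_space)
  define I where "I = {(V, W). V \<in> B \<and> W \<in> B \<and> X closure_of V \<subseteq> W}"
  have "I \<subseteq> B \<times> B"
    by (auto simp: I_def)
  then have countI: "countable I"
    using countable_subset countable_SIGMA B(1) by metis
  have "\<forall>i\<in>I. \<exists>f. continuous_map X euclideanreal f \<and> f ` (X closure_of (fst i)) \<subseteq> {0::real} \<and>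
      f ` (topspace X - snd i) \<subseteq> {1}"
  proof
    fix i assume "i \<in> I"
    then have "openin X (snd i)" "X closure_of (fst i) \<subseteq> snd i"
      using B by (auto simp: I_def)
    then have "closedin X (topspace X - snd i)" "disjnt (X closure_of (fst i)) (topspace X - snd i)"
      by (auto simp: disjnt_def)
    then obtain f where "continuous_map X euclideanreal f" "f ` (X closure_of (fst i)) \<subseteq> {0::real}"
        "f ` (topspace X - snd i) \<subseteq> {1}"
      using Urysohn_lemma_alt [OF normal closedin_closure_of] by metis
    then show "\<exists>f. continuous_map X euclideanreal f \<and> f ` (X closure_of (fst i)) \<subseteq> {0::real} \<and>
      f ` (topspace X - snd i) \<subseteq> {1}"
      by blast
  qed
  then obtain f where f: "\<And>i. i \<in> I \<Longrightarrow> continuous_map X euclideanreal (f i)"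
    "\<And>i. i \<in> I \<Longrightarrow> f i ` (X closure_of (fst i)) \<subseteq> {0::real}"
    "\<And>i. i \<in> I \<Longrightarrow> f i ` (topspace X - snd i) \<subseteq> {1}"
    by metis
  \<comment> \<open>Regularity places a closed \<open>D\<close> between a neighbourhood of
    \<open>x\<close> and \<open>W\<close>. A basic \<open>V\<close> around \<open>x\<close> below
    \<open>D\<close> then has its closure inside \<open>W\<close>, so \<open>(V, W)\<close> belongs
    to \<open>I\<close>.\<close>
  have sep: "\<exists>i\<in>I. f i x = 0 \<and> (\<forall>y\<in>topspace X - U. f i y = 1)" if "openin X U" "x \<in> U" for U x
  proof -
    obtain W where W: "W \<in> B" "x \<in> W" "W \<subseteq> U"
      using base \<open>openin X U\<close> \<open>x \<in> U\<close> by blast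
    obtain G D where G: "openin X G" "closedin X D" "x \<in> G" "G \<subseteq> D" "D \<subseteq> W"
      using assms(1) W B(2) unfolding neighbourhood_base_of_closedin [symmetric] neighbourhood_base_of
      by meson
    obtain V where V: "V \<in> B" "x \<in> V" "V \<subseteq> G"
      using base G by blast
    have "X closure_of V \<subseteq> W"
      using G V by (meson closure_of_minimal order_trans)
    moreover have "x \<in> X closure_of V"
      using V B(2) by (meson closure_of_subset openin_subset subsetD)
    ultimately have "(V, W) \<in> I" "f (V, W) x = 0"
      using V W f(2) [of "(V, W)"] by (auto simp: I_def)
    moreover have "\<forall>y\<in>topspace X - U. f (V, W) y = 1"
      using f(3) [OF \<open>(V, W) \<in> I\<close>] W by auto
    ultimately show ?thesis by blast
  qed
  define P where "P = product_topology (\<lambda>_. euclideanreal) I"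
  define e where "e = (\<lambda>x. \<lambda>i\<in>I. f i x)"
  have contE: "continuous_map X P e"
    unfolding P_def e_def by (auto simp: continuous_map_componentwise f)
  have inj: "inj_on e (topspace X)"
  proof (rule inj_onI, rule ccontr)
    fix x y assume xy: "x \<in> topspace X" "y \<in> topspace X" "e x = e y" "x \<noteq> y"
    then have "openin X (topspace X - {y})"
      using assms(2) by (simp add: closedin_Hausdorff_singleton openin_diff)
    then obtain i where "i \<in> I" "f i x = 0" "f i y = 1"
      using sep [of "topspace X - {y}" x] xy by auto
    then show False
      using fun_cong [OF xy(3), of i] by (simp add: e_def)
  qed
  have "open_map X (subtopology P (e ` topspace X)) e"
    unfolding open_map_def
  proof (intro allI impI)
    fix W assume W: "openin X W"
    show "openin (subtopology P (e ` topspace X)) (e ` W)"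
    proof (subst openin_subopen, intro ballI)
      fix z assume "z \<in> e ` W"
      then obtain x where x: "x \<in> W" "z = e x" by blast
      then obtain i where i: "i \<in> I" "f i x = 0" "\<forall>y\<in>topspace X - W. f i y = 1"
        using sep W by blast
      \<comment> \<open>This cylinder contains \<open>e x\<close>, whose coordinate \<open>i\<close>
        is 0, and every image point in it comes from \<open>W\<close>, because \<open>f i\<close> is
        1 off \<open>W\<close>.\<close>
      have "openin P {z \<in> topspace P. z i \<in> {..<1}}"
        unfolding P_def using i(1)
        by (intro openin_continuous_map_preimage [of _ euclideanreal] continuous_map_product_projection) auto
      then have "openin (subtopology P (e ` topspace X))
          ({z \<in> topspace P. z i \<in> {..<1}} \<inter> e ` topspace X)"
        by (auto simp: openin_subtopology)
      moreover have "z \<in> {z \<in> topspace P. z i \<in> {..<1}} \<inter> e ` topspace X"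
        using x i W openin_subset contE by (fastforce simp: e_def P_def)
      moreover have "{z \<in> topspace P. z i \<in> {..<1}} \<inter> e ` topspace X \<subseteq> e ` W"
        using i by (force simp: e_def)
      ultimately show "\<exists>T. openin (subtopology P (e ` topspace X)) T \<and> z \<in> T \<and> T \<subseteq> e ` W"
        by blast
    qed
  qed
  moreover have "e ` topspace X \<subseteq> topspace P"
    using contE by (simp add: continuous_map_image_subset_topspace)
  ultimately have "homeomorphic_map X (subtopology P (e ` topspace X)) e"
    by (intro bijective_open_imp_homeomorphic_map)
      (auto simp: contE continuous_map_in_subtopology inj)
  moreover have "metrizable_space P"
    unfolding P_def metrizable_space_product_topology
    using countI by (auto intro: metrizable_space_euclidean countable_subset [OF _ countI])
  ultimately show ?thesis
    using homeomorphic_map_imp_homeomorphic_space homeomorphic_metrizable_space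
      metrizable_space_subtopology by blast
qed

text \<open>Since each member is open, the basic sets of its subspace are open in \<open>X\<close>,
  and the countably many countable bases can be merged.\<close>

lemma second_countable_UN_open:
  assumes "countable \<W>" and "\<And>W. W \<in> \<W> \<Longrightarrow> openin X W"
    and "\<And>W. W \<in> \<W> \<Longrightarrow> second_countable (subtopology X W)"
  shows "second_countable (subtopology X (\<Union>\<W>))"
proof -
  have "\<forall>W\<in>\<W>. \<exists>B. countable B \<and> (\<forall>V\<in>B. openin (subtopology X W) V) \<and>
      (\<forall>U x. openin (subtopology X W) U \<and> x \<in> U \<longrightarrow> (\<exists>V\<in>B. x \<in> V \<and> V \<subseteq> U))"
    using assms(3) unfolding second_countable_def by blast
  then obtain B where B: "\<And>W. W \<in> \<W> \<Longrightarrow> countable (B W)"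
    "\<And>W V. W \<in> \<W> \<Longrightarrow> V \<in> B W \<Longrightarrow> openin (subtopology X W) V"
    "\<And>W U x. W \<in> \<W> \<Longrightarrow> openin (subtopology X W) U \<Longrightarrow> x \<in> U \<Longrightarrow> \<exists>V\<in>B W. x \<in> V \<and> V \<subseteq> U"
    by metis
  have openX: "openin X V \<and> V \<subseteq> W" if "W \<in> \<W>" "V \<in> B W" for V W
    using B(2) [OF that] assms(2) [OF \<open>W \<in> \<W>\<close>] by (simp add: openin_open_subtopology)
  show ?thesis
    unfolding second_countable_def
  proof (intro exI conjI ballI allI impI)
    show "countable (\<Union>W\<in>\<W>. B W)"
      using assms(1) B(1) by blast
    show "openin (subtopology X (\<Union>\<W>)) V" if V: "V \<in> (\<Union>W\<in>\<W>. B W)" for V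
    proof -
      obtain W where "W \<in> \<W>" "V \<in> B W"
        using V by blast
      with openX have "openin X V" "V \<subseteq> \<Union>\<W>"
        by blast+
      then show ?thesis
        by (rule subset_openin_subtopology)
    qed
    show "\<exists>V\<in>\<Union>W\<in>\<W>. B W. x \<in> V \<and> V \<subseteq> U"
      if U: "openin (subtopology X (\<Union>\<W>)) U \<and> x \<in> U" for U x
    proof -
      obtain T where T: "openin X T" "U = T \<inter> \<Union>\<W>"
        using U unfolding openin_subtopology by blast
      obtain W where W: "W \<in> \<W>" "x \<in> W"
        using U T by blast
      have "openin (subtopology X W) (T \<inter> W)"
        using T by (auto simp: openin_subtopology)
      then obtain V where "V \<in> B W" "x \<in> V" "V \<subseteq> T \<inter> W"
        using B(3) W T U by blast
      then show ?thesis
        using W T by blast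
    qed
  qed
qed

text \<open>By compactness each \<open>K\<close> is covered by finitely many second countable open
  sets. Taken over all \<open>K\<close> these form a countable family, whose union is second
  countable and so metrizable; metrizability passes to subspaces.\<close>

lemma metrizable_countable_Union_compact:
  assumes "regular_space X" "Hausdorff_space X"
    and loc: "\<And>x. x \<in> topspace X \<Longrightarrow> \<exists>W. openin X W \<and> x \<in> W \<and> second_countable (subtopology X W)"
    and "countable \<K>" and K: "\<And>K. K \<in> \<K> \<Longrightarrow> compactin X K"
  shows "metrizable_space (subtopology X (\<Union>\<K>))"
proof -
  have "\<forall>K\<in>\<K>. \<exists>F. finite F \<and> K \<subseteq> \<Union>F \<and> F \<subseteq> {W. openin X W \<and> second_countable (subtopology X W)}"
  proof
    fix K assume "K \<in> \<K>"
    then have "compactin X K" by (rule K)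
    then have "K \<subseteq> \<Union>{W. openin X W \<and> second_countable (subtopology X W)}"
      using loc compactin_subset_topspace by fastforce
    with \<open>compactin X K\<close> show "\<exists>F. finite F \<and> K \<subseteq> \<Union>F \<and>
        F \<subseteq> {W. openin X W \<and> second_countable (subtopology X W)}"
      using compactinD [of X K "{W. openin X W \<and> second_countable (subtopology X W)}"] by auto
  qed
  then obtain F where F: "\<And>K. K \<in> \<K> \<Longrightarrow> finite (F K)" "\<And>K. K \<in> \<K> \<Longrightarrow> K \<subseteq> \<Union>(F K)"
    "\<And>K. K \<in> \<K> \<Longrightarrow> F K \<subseteq> {W. openin X W \<and> second_countable (subtopology X W)}"
    by metis
  define \<W> where "\<W> = (\<Union>K\<in>\<K>. F K)"
  have "countable \<W>"
    unfolding \<W>_def using F(1) \<open>countable \<K>\<close> by (simp add: countable_finite)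
  then have "second_countable (subtopology X (\<Union>\<W>))"
    by (rule second_countable_UN_open) (use F(3) in \<open>auto simp: \<W>_def\<close>)
  then have "metrizable_space (subtopology X (\<Union>\<W>))"
    using assms(1,2) by (intro regular_second_countable_imp_metrizable_space)
      (auto simp: regular_space_subtopology Hausdorff_space_subtopology)
  then have "metrizable_space (subtopology (subtopology X (\<Union>\<W>)) (\<Union>\<K>))"
    by (rule metrizable_space_subtopology)
  moreover have "\<Union>\<K> \<subseteq> \<Union>\<W>"
    using F(2) by (fastforce simp: \<W>_def)
  ultimately show ?thesis
    by (simp add: subtopology_subtopology Int_absorb1)
qed

text \<open>Convergent sequences decide closedness in a first countable space, and a finer Hausdorff
  topology agrees with the coarser one on its compact sets.\<close>

lemma subtopology_eq_if_countable_subsets_in_compact: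
  assumes "continuous_map L M id" "topspace L = topspace M" "Hausdorff_space M" "first_countable M"
    and S: "S \<subseteq> topspace M"
    and cpt: "\<And>C. \<lbrakk>countable C; C \<subseteq> S\<rbrakk> \<Longrightarrow> \<exists>K. compactin L K \<and> C \<subseteq> K"
  shows "subtopology L S = subtopology M S"
proof -
  have finer: "openin L T" if "openin M T" for T
    using assms(1) openin_subset [OF that] that assms(2)
    unfolding continuous_map_def by (auto simp: Collect_conj_eq Int_absorb1)
  have "openin (subtopology M S) (S \<inter> T)" if T: "openin L T" for T
  proof (subst openin_subopen, intro ballI)
    fix x assume x: "x \<in> S \<inter> T"
    obtain B where B: "countable B" "\<And>V. V \<in> B \<Longrightarrow> openin M V"
      "\<And>U. openin M U \<Longrightarrow> x \<in> U \<Longrightarrow> \<exists>V\<in>B. x \<in> V \<and> V \<subseteq> U"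
      using assms(4) x S unfolding first_countable_def by (metis IntD1 subsetD)
    show "\<exists>W. openin (subtopology M S) W \<and> x \<in> W \<and> W \<subseteq> S \<inter> T"
    proof (rule ccontr)
      assume no: "\<not> ?thesis"
      \<comment> \<open>If no relative neighbourhood of \<open>x\<close> stays in \<open>T\<close>,
        every basic \<open>V\<close> around \<open>x\<close> contains a point \<open>a V\<close> of
        \<open>S\<close> outside \<open>T\<close>. For \<open>V\<close> not containing
        \<open>x\<close> the value \<open>a V\<close> is arbitrary, and it is left out of
        \<open>C\<close>.\<close>
      have "\<forall>V\<in>B. \<exists>a. x \<in> V \<longrightarrow> a \<in> (S - T) \<inter> V"
      proof
        fix V assume V: "V \<in> B"
        have "openin (subtopology M S) (V \<inter> S)"
          using B(2) [OF V] by (auto simp: openin_subtopology)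
        then show "\<exists>a. x \<in> V \<longrightarrow> a \<in> (S - T) \<inter> V"
          using no x by blast
      qed
      then obtain a where a: "\<And>V. V \<in> B \<Longrightarrow> x \<in> V \<Longrightarrow> a V \<in> (S - T) \<inter> V"
        by metis
      define C where "C = insert x (a ` {V \<in> B. x \<in> V})"
      have "countable C" "C \<subseteq> S"
        using B(1) a x by (auto simp: C_def)
      then obtain K where K: "compactin L K" "C \<subseteq> K"
        using cpt by blast
      \<comment> \<open>\<open>K - T\<close> is compact in \<open>L\<close>, hence in
        \<open>M\<close>, hence closed in \<open>M\<close>, and it misses \<open>x\<close>. So some
        basic \<open>V\<close> around \<open>x\<close> avoids it, although \<open>a V\<close> lies
        in it.\<close>
      have "compactin L (K - T)"
        using K(1) T by (metis Int_Diff closed_Int_compactin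
            closedin_diff closedin_topspace compactin_subset_topspace inf.absorb_iff2 inf.commute)
      then have "compactin M (K - T)"
        using image_compactin [OF _ assms(1)] by fastforce
      then have "openin M (topspace M - (K - T))"
        using assms(3) compactin_imp_closedin by blast
      then obtain V where V: "V \<in> B" "x \<in> V" "V \<subseteq> topspace M - (K - T)"
        using B(3) x S by blast
      then have "a V \<in> K - T"
        using a K(2) by (auto simp: C_def)
      then show False
        using a V by blast
    qed
  qed
  then have "openin (subtopology L S) U = openin (subtopology M S) U" for U
    using finer by (metis inf_commute openin_subtopology)
  then show ?thesis
    by (simp add: topology_eq)
qed

subsection \<open>Charts of manifolds\<close>

lemma second_countable_Euclidean_space: "second_countable (Euclidean_space n)"
proof -
  obtain B :: "(nat \<Rightarrow> real) set set" where "countable B" "topological_basis B"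
    using ex_countable_basis by blast
  then have "second_countable (euclidean :: (nat \<Rightarrow> real) topology)"
    unfolding second_countable_def open_openin [symmetric]
    by (meson topological_basisE topological_basis_open)
  then show ?thesis
    unfolding Euclidean_space_def euclidean_product_topology by (rule second_countable_subtopology)
qed

context
  fixes n :: nat and M :: "'a topology" and U \<phi>
  assumes chart: "chart_on n M U \<phi>"
begin

lemma chart_on_openin: "openin M U"
  using chart by (simp add: chart_on_def)

lemma chart_on_homeomorphic:
  obtains V where "openin (Euclidean_space n) V"
    "homeomorphic_map (subtopology M U) (subtopology (Euclidean_space n) V) \<phi>"
  using chart by (auto simp: chart_on_def)

lemma chart_on_second_countable: "second_countable (subtopology M U)"
  by (metis chart_on_homeomorphic homeomorphic_map_imp_homeomorphic_space
      homeomorphic_space_second_countability second_countable_Euclidean_space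
      second_countable_subtopology)

lemma chart_on_locally_compact: "locally_compact_space (subtopology M U)"
proof -
  obtain V where V: "openin (Euclidean_space n) V"
    "homeomorphic_map (subtopology M U) (subtopology (Euclidean_space n) V) \<phi>"
    using chart_on_homeomorphic .
  have "locally_compact_space (subtopology (Euclidean_space n) V)"
    using V(1) locally_compact_Euclidean_space Hausdorff_Euclidean_space
      locally_compact_space_open_subset by blast
  then show ?thesis
    using V(2) homeomorphic_locally_compact_space homeomorphic_map_imp_homeomorphic_space by blast
qed

lemma chart_on_continuous_coordinate: "continuous_map (subtopology M U) euclideanreal (\<lambda>q. \<phi> q i)"
proof -
  obtain V where "homeomorphic_map (subtopology M U) (subtopology (Euclidean_space n) V) \<phi>"
    using chart_on_homeomorphic .
  then have "continuous_map (subtopology M U) (powertop_real UNIV) \<phi>"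
    using homeomorphic_imp_continuous_map
    by (fastforce simp: Euclidean_space_def continuous_map_in_subtopology)
  then show ?thesis
    by (simp add: continuous_map_componentwise_UNIV)
qed

text \<open>The transverse coordinate is continuous and points are closed in the product topology.
  Closedness is relative to \<open>U\<close>; a slice need not be closed in
  \<open>M\<close>.\<close>

lemma chart_on_closedin_slice:
  "closedin (subtopology M U) {q \<in> U. transverse (\<phi> q) = c}"
proof -
  have "continuous_map (subtopology M U) (powertop_real UNIV) (\<lambda>q. transverse (\<phi> q))"
    by (auto simp: continuous_map_componentwise_UNIV transverse_def chart_on_continuous_coordinate)
  then have "closedin (subtopology M U) {q \<in> topspace (subtopology M U). transverse (\<phi> q) \<in> {c}}"
    by (rule closedin_continuous_map_preimage) (simp add: euclidean_product_topology)
  then show ?thesis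
    using openin_subset [OF chart_on_openin] by (simp add: Int_absorb1)
qed

text \<open>Coordinate 0 and the transverse coordinates make up all of \<open>\<phi>\<close>, which
  is injective on \<open>U\<close>. This identifies points obtained from the intermediate value
  theorem.\<close>

lemma chart_on_eqI:
  assumes "a \<in> U" "b \<in> U" "transverse (\<phi> a) = transverse (\<phi> b)" "\<phi> a 0 = \<phi> b 0"
  shows "a = b"
proof -
  have "\<phi> a = \<phi> b"
  proof
    fix i show "\<phi> a i = \<phi> b i"
      using assms(4) fun_cong [OF assms(3), of "i - 1"] by (cases i) (simp_all add: transverse_def)
  qed
  moreover have "inj_on \<phi> U"
    using chart_on_homeomorphic homeomorphic_imp_injective_map openin_subset [OF chart_on_openin]
    by (metis topspace_subtopology_subset)
  ultimately show ?thesis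
    using assms by (auto dest: inj_onD)
qed

end

lemma manifold_first_countable:
  assumes "manifold n M"
  shows "first_countable M"
  unfolding first_countable_def
proof
  fix x assume x: "x \<in> topspace M"
  obtain U \<phi> where U: "x \<in> U" "chart_on n M U \<phi>"
    using assms x unfolding manifold_def by blast
  then have "x \<in> topspace (subtopology M U)" "first_countable (subtopology M U)" "openin M U"
    using x chart_on_openin [OF U(2)]
      second_countable_imp_first_countable [OF chart_on_second_countable [OF U(2)]] by auto
  then obtain B where B: "countable B" "\<And>V. V \<in> B \<Longrightarrow> openin (subtopology M U) V"
      "\<And>W. openin (subtopology M U) W \<Longrightarrow> x \<in> W \<Longrightarrow> \<exists>V\<in>B. x \<in> V \<and> V \<subseteq> W"
    unfolding first_countable_def by metis
  have "\<exists>V\<in>B. x \<in> V \<and> V \<subseteq> W" if "openin M W" "x \<in> W" for W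
    using B(3) [of "W \<inter> U"] that U(1) by (auto simp: openin_subtopology_Int)
  moreover have "openin M V" if "V \<in> B" for V
    using B(2) [OF that] \<open>openin M U\<close> openin_trans_full by blast
  ultimately show "\<exists>\<B>. countable \<B> \<and> (\<forall>V\<in>\<B>. openin M V) \<and>
      (\<forall>U. openin M U \<and> x \<in> U \<longrightarrow> (\<exists>V\<in>\<B>. x \<in> V \<and> V \<subseteq> U))"
    using B(1) by blast
qed

text \<open>Charts provide compact neighbourhoods, and locally compact Hausdorff spaces are
  regular.\<close>

lemma manifold_regular:
  assumes "manifold n M"
  shows "regular_space M"
proof -
  have "Hausdorff_space M"
    using assms by (simp add: manifold_def)
  moreover have "locally_compact_space M"
    unfolding locally_compact_space_def
  proof
    fix x assume x: "x \<in> topspace M"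
    obtain U \<phi> where U: "x \<in> U" "chart_on n M U \<phi>"
      using assms x unfolding manifold_def by blast
    then have "x \<in> topspace (subtopology M U)" "locally_compact_space (subtopology M U)" "openin M U"
      using x chart_on_locally_compact chart_on_openin by auto
    then obtain W K where "openin (subtopology M U) W" "compactin (subtopology M U) K" "x \<in> W" "W \<subseteq> K"
      unfolding locally_compact_space_def by metis
    with \<open>openin M U\<close> show "\<exists>W K. openin M W \<and> compactin M K \<and> x \<in> W \<and> W \<subseteq> K"
      by (meson compactin_subtopology openin_trans_full)
  qed
  ultimately show ?thesis
    using locally_compact_Hausdorff_imp_regular_space by blast
qed

subsection \<open>The leaf topology\<close>

locale foliated_manifold =
  fixes n :: nat and M :: "'a topology" and \<A> :: "('a set \<times> ('a \<Rightarrow> nat \<Rightarrow> real)) set"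
  assumes manifold: "manifold n M"
    and foliation: "one_dim_foliation n M \<A>"
begin

abbreviation L :: "'a topology" where "L \<equiv> leaf_topology M \<A>"

lemma atlas_chart: "(U, \<phi>) \<in> \<A> \<Longrightarrow> chart_on n M U \<phi>"
  using foliation by (auto simp: one_dim_foliation_def)

lemma atlas_cover:
  assumes "p \<in> topspace M"
  obtains U \<phi> where "(U, \<phi>) \<in> \<A>" "p \<in> U"
  using assms foliation by (fastforce simp: one_dim_foliation_def)

lemma atlas_overlap:
  assumes "(U, \<phi>) \<in> \<A>" "(V, \<psi>) \<in> \<A>" "p \<in> U \<inter> V"
  shows "\<exists>W h. openin M W \<and> p \<in> W \<and> W \<subseteq> U \<inter> V \<and> (\<forall>q\<in>W. transverse (\<psi> q) = h (transverse (\<phi> q)))"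
proof -
  have "\<forall>(U, \<phi>)\<in>\<A>. \<forall>(V, \<psi>)\<in>\<A>. \<forall>p\<in>U \<inter> V. \<exists>W h. openin M W \<and> p \<in> W \<and> W \<subseteq> U \<inter> V \<and>
      (\<forall>q\<in>W. transverse (\<psi> q) = h (transverse (\<phi> q)))"
    using foliation unfolding one_dim_foliation_def by (elim conjE)
  from bspec [OF bspec [OF this assms(1), simplified] assms(2), simplified] show ?thesis
    using assms(3) by auto
qed

lemma openin_leaf_topology_slice:
  assumes "(U, \<phi>) \<in> \<A>" "openin M T" "T \<subseteq> U"
  shows "openin L {q \<in> T. transverse (\<phi> q) = c}"
  unfolding leaf_topology_def using assms by (intro topology_generated_by_Basis) blast

lemma openin_leaf_topology_plaque:
  "(U, \<phi>) \<in> \<A> \<Longrightarrow> openin L {q \<in> U. transverse (\<phi> q) = c}"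
  using openin_leaf_topology_slice chart_on_openin [OF atlas_chart] by blast

lemma topspace_leaf_topology: "topspace L = topspace M"
proof
  show "topspace L \<subseteq> topspace M"
    unfolding leaf_topology_def topology_generated_by_topspace using openin_subset by blast
  show "topspace M \<subseteq> topspace L"
  proof
    fix p assume "p \<in> topspace M"
    then obtain U \<phi> where "(U, \<phi>) \<in> \<A>" "p \<in> U"
      by (rule atlas_cover)
    then show "p \<in> topspace L"
      using openin_subset [OF openin_leaf_topology_plaque [of U \<phi> "transverse (\<phi> p)"]] by blast
  qed
qed

text \<open>The slice of \<open>T \<inter> U\<close> through \<open>p\<close> is a generator of
  \<open>L\<close> inside \<open>T\<close>.\<close>

lemma openin_leaf_topology_finer:
  assumes "openin M T"
  shows "openin L T"
proof (subst openin_subopen, intro ballI)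
  fix p assume "p \<in> T"
  then obtain U \<phi> where U: "(U, \<phi>) \<in> \<A>" "p \<in> U"
    using assms openin_subset atlas_cover by (metis subsetD)
  have "openin L {q \<in> T \<inter> U. transverse (\<phi> q) = transverse (\<phi> p)}"
    using chart_on_openin [OF atlas_chart [OF U(1)]] assms
    by (intro openin_leaf_topology_slice [OF U(1)]) auto
  then show "\<exists>S. openin L S \<and> p \<in> S \<and> S \<subseteq> T"
    using U \<open>p \<in> T\<close> by (intro exI [of _ "{q \<in> T \<inter> U. transverse (\<phi> q) = transverse (\<phi> p)}"]) auto
qed

lemma continuous_map_leaf_topology: "continuous_map L M id"
  unfolding continuous_map_alt using openin_leaf_topology_finer
  by (auto simp: topspace_leaf_topology)

lemma Hausdorff_space_leaf_topology: "Hausdorff_space L"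
  using manifold continuous_map_leaf_topology
  by (auto simp: manifold_def Hausdorff_space_injective_preimage)

text \<open>Compatibility of the charts enters here: near a point of an overlap the transverse
  coordinate of another chart is a function of that of \<open>\<phi>\<close>, hence constant along
  the plaque. So the generators from other charts cut the plaque in sets that are relatively open
  for \<open>M\<close>.\<close>

lemma subtopology_leaf_topology_plaque:
  assumes U: "(U, \<phi>) \<in> \<A>"
  shows "subtopology L {q \<in> U. transverse (\<phi> q) = c} = subtopology M {q \<in> U. transverse (\<phi> q) = c}"
    (is "subtopology L ?P = subtopology M ?P")
proof -
  have P: "?P \<subseteq> topspace M"
    using openin_subset [OF chart_on_openin [OF atlas_chart [OF U]]] by blast
  have cont: "continuous_map (subtopology M ?P) L id"
    unfolding leaf_topology_def
  proof (rule continuous_on_generated_topo)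
    show "id ` topspace (subtopology M ?P) \<subseteq>
        \<Union>{{q \<in> O'. transverse (\<phi> q) = c} |O' U \<phi> c. (U, \<phi>) \<in> \<A> \<and> openin M O' \<and> O' \<subseteq> U}"
      using topspace_leaf_topology unfolding leaf_topology_def by auto
    fix G assume "G \<in> {{q \<in> O'. transverse (\<phi> q) = c} |O' U \<phi> c. (U, \<phi>) \<in> \<A> \<and> openin M O' \<and> O' \<subseteq> U}"
    then obtain T V \<psi> e where G: "G = {q \<in> T. transverse (\<psi> q) = e}" "(V, \<psi>) \<in> \<A>" "openin M T" "T \<subseteq> V"
      by blast
    have "openin (subtopology M ?P) (G \<inter> ?P)"
    proof (subst openin_subopen, intro ballI)
      fix x assume x: "x \<in> G \<inter> ?P"
      then have "x \<in> U \<inter> V"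
        using G by blast
      then obtain W h where W: "openin M W" "x \<in> W" "W \<subseteq> U \<inter> V"
        and h: "\<And>q. q \<in> W \<Longrightarrow> transverse (\<psi> q) = h (transverse (\<phi> q))"
        using atlas_overlap [OF U G(2) \<open>x \<in> U \<inter> V\<close>] by metis
      \<comment> \<open>On \<open>W \<inter> ?P\<close> the value of
        \<open>transverse (\<psi> q)\<close> is constantly \<open>h c\<close>, and
        \<open>h c = e\<close> because \<open>x\<close> lies in \<open>G\<close>.\<close>
      have "W \<inter> T \<inter> ?P \<subseteq> G \<inter> ?P"
        using x W(2) by (auto simp: G(1) h)
      moreover have "openin (subtopology M ?P) (W \<inter> T \<inter> ?P)"
        using W G by (simp add: openin_Int openin_subtopology_Int)
      ultimately show "\<exists>S. openin (subtopology M ?P) S \<and> x \<in> S \<and> S \<subseteq> G \<inter> ?P"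
        using x W G by (intro exI [of _ "W \<inter> T \<inter> ?P"]) auto
    qed
    then show "openin (subtopology M ?P) (id -` G \<inter> topspace (subtopology M ?P))"
      using P by (simp add: Int_absorb1)
  qed
  have "openin (subtopology M ?P) (T \<inter> ?P)" if "openin L T" for T
  proof -
    have "{q \<in> topspace (subtopology M ?P). id q \<in> T} = T \<inter> ?P"
      using P by auto
    with openin_continuous_map_preimage [OF cont that] show ?thesis
      by (simp only:)
  qed
  then have "openin (subtopology L ?P) S = openin (subtopology M ?P) S" for S
    using openin_leaf_topology_finer unfolding openin_subtopology [of L] openin_subtopology [of M] by blast
  then show ?thesis
    by (simp add: topology_eq)
qed

text \<open>Regularity of \<open>M\<close> is transferred through a plaque, which is open in
  \<open>L\<close> and carries the topology induced from \<open>M\<close>.\<close>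

lemma regular_space_leaf_topology: "regular_space L"
  unfolding neighbourhood_base_of_closedin [symmetric] neighbourhood_base_of
proof (intro allI impI, elim conjE)
  fix W x assume W: "openin L W" "x \<in> W"
  then have "x \<in> topspace M"
    using openin_subset topspace_leaf_topology by blast
  then obtain U \<phi> where U: "(U, \<phi>) \<in> \<A>" "x \<in> U"
    by (rule atlas_cover)
  note chart = atlas_chart [OF U(1)]
  define P where "P = {q \<in> U. transverse (\<phi> q) = transverse (\<phi> x)}"
  have "x \<in> P"
    using U by (simp add: P_def)
  have "openin (subtopology M P) (W \<inter> P)"
    using openin_subtopology_Int [OF W(1), of P]
    unfolding P_def subtopology_leaf_topology_plaque [OF U(1)] .
  then obtain T where T: "openin M T" "W \<inter> P = T \<inter> P"
    by (metis openin_subtopology)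
  have "openin M (T \<inter> U)" "x \<in> T \<inter> U"
    using T chart_on_openin [OF chart] W U \<open>x \<in> P\<close> by auto
  then obtain V D where V: "openin M V" "closedin M D" "x \<in> V" "V \<subseteq> D" "D \<subseteq> T \<inter> U"
    using manifold_regular [OF manifold]
    unfolding neighbourhood_base_of_closedin [symmetric] neighbourhood_base_of by meson
  have "closedin (subtopology M U) P"
    unfolding P_def by (rule chart_on_closedin_slice [OF chart])
  then obtain C where C: "closedin M C" "P = C \<inter> U"
    by (metis closedin_subtopology)
  \<comment> \<open>\<open>P\<close> is closed only relative to \<open>U\<close>. Since
    \<open>D\<close> was chosen inside \<open>U\<close>, the part of \<open>P\<close> in
    \<open>D\<close> is closed in \<open>M\<close>.\<close>
  then have "D \<inter> P = D \<inter> C"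
    using V by blast
  then have "closedin M (D \<inter> P)"
    using C V by auto
  then have "closedin L (D \<inter> P)"
    using openin_leaf_topology_finer by (simp add: closedin_def topspace_leaf_topology)
  moreover have "openin L (V \<inter> P)"
    using openin_leaf_topology_finer [OF V(1)] openin_leaf_topology_plaque [OF U(1)]
    by (simp add: P_def openin_Int)
  ultimately show "\<exists>U V. openin L U \<and> closedin L V \<and> x \<in> U \<and> U \<subseteq> V \<and> V \<subseteq> W"
    using V T \<open>x \<in> P\<close> by (intro exI [of _ "V \<inter> P"] exI [of _ "D \<inter> P"]) auto
qed

text \<open>A plaque is open in \<open>L\<close> and is a subspace of a chart domain, which is
  second countable.\<close>

lemma leaf_topology_locally_second_countable:
  assumes "x \<in> topspace L"
  shows "\<exists>W. openin L W \<and> x \<in> W \<and> second_countable (subtopology L W)"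
proof -
  obtain U \<phi> where U: "(U, \<phi>) \<in> \<A>" "x \<in> U"
    using assms atlas_cover topspace_leaf_topology by metis
  define P where "P = {q \<in> U. transverse (\<phi> q) = transverse (\<phi> x)}"
  have "subtopology L P = subtopology (subtopology M U) P"
    using subtopology_leaf_topology_plaque [OF U(1)]
    by (simp add: P_def subtopology_subtopology Int_absorb1 Collect_restrict)
  then have "second_countable (subtopology L P)"
    by (simp add: second_countable_subtopology chart_on_second_countable [OF atlas_chart [OF U(1)]])
  then show ?thesis
    using openin_leaf_topology_plaque [OF U(1)] U(2) P_def by blast
qed

section \<open>Paths of the leaf topology in a foliated chart\<close>

lemma continuous_on_coordinate_path:
  assumes U: "(U, \<phi>) \<in> \<A>" and "pathin L \<gamma>" "T \<subseteq> {0..1}" "\<gamma> ` T \<subseteq> U"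
  shows "continuous_on T (\<lambda>t. \<phi> (\<gamma> t) 0)"
proof -
  have "continuous_map (top_of_set {0..1}) M \<gamma>"
    using continuous_map_compose [OF _ continuous_map_leaf_topology] assms(2)
    by (fastforce simp: pathin_def)
  then have "continuous_map (top_of_set T) (subtopology M U) \<gamma>"
    using assms(3,4)
    by (auto simp: continuous_map_in_subtopology intro: continuous_map_from_subtopology_mono)
  then have "continuous_map (top_of_set T) euclideanreal ((\<lambda>q. \<phi> q 0) \<circ> \<gamma>)"
    using chart_on_continuous_coordinate [OF atlas_chart [OF U]] by (rule continuous_map_compose)
  then show ?thesis
    by (simp add: o_def)
qed

text \<open>Plaques are open in \<open>L\<close>, so continuity into \<open>L\<close> keeps the path
  in its plaque for a while; continuity into \<open>M\<close> would only keep it in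
  \<open>U\<close>.\<close>

lemma path_stays_in_plaque:
  assumes U: "(U, \<phi>) \<in> \<A>" and \<gamma>: "pathin L \<gamma>" and t: "t \<in> {0..1}" "\<gamma> t \<in> U"
  obtains \<epsilon> where "0 < \<epsilon>"
    "\<And>s. \<lbrakk>s \<in> {0..1}; \<bar>s - t\<bar> < \<epsilon>\<rbrakk> \<Longrightarrow> \<gamma> s \<in> U \<and> transverse (\<phi> (\<gamma> s)) = transverse (\<phi> (\<gamma> t))"
proof -
  define P where "P = {q \<in> U. transverse (\<phi> q) = transverse (\<phi> (\<gamma> t))}"
  have "openin (top_of_set {0..1}) {s \<in> topspace (top_of_set {0..1}). \<gamma> s \<in> P}"
    using \<gamma> openin_leaf_topology_plaque [OF U] unfolding pathin_def P_def
    by (intro openin_continuous_map_preimage [of _ L])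
  then obtain T where T: "open T" "{s \<in> {0..1}. \<gamma> s \<in> P} = {0..1} \<inter> T"
    by (auto simp: openin_open)
  moreover have "t \<in> T"
    using T(2) t by (auto simp: P_def)
  ultimately obtain \<epsilon> where "0 < \<epsilon>" "\<And>s. dist s t < \<epsilon> \<Longrightarrow> s \<in> T"
    by (metis open_dist)
  then show ?thesis
    using T(2) by (intro that [of \<epsilon>]) (auto simp: P_def dist_real_def)
qed

subsection \<open>Arcs in the leaves\<close>

lemma pathin_leaf_topology_in_topspace: "pathin L \<gamma> \<Longrightarrow> t \<in> {0..1} \<Longrightarrow> \<gamma> t \<in> topspace M"
  unfolding pathin_def using continuous_map_image_subset_topspace topspace_leaf_topology by fastforce

text \<open>In the coordinate along a plaque an arc is strictly monotone near an interior parameter, so it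
  covers a neighbourhood of its point there.\<close>

lemma openin_leaf_topology_arc_interior:
  assumes \<gamma>: "pathin L \<gamma>" and inj: "inj_on \<gamma> {0..1}"
  shows "openin L (\<gamma> ` {0<..<1})"
proof (subst openin_subopen, intro ballI)
  fix x assume "x \<in> \<gamma> ` {0<..<1}"
  then obtain t where t: "0 < t" "t < 1" "x = \<gamma> t"
    by auto
  obtain U \<phi> where U: "(U, \<phi>) \<in> \<A>" "\<gamma> t \<in> U"
    using pathin_leaf_topology_in_topspace [OF \<gamma>, of t] t atlas_cover by auto
  note chart = atlas_chart [OF U(1)]
  obtain \<epsilon> where \<epsilon>: "0 < \<epsilon>"
    "\<And>s. \<lbrakk>s \<in> {0..1}; \<bar>s - t\<bar> < \<epsilon>\<rbrakk> \<Longrightarrow> \<gamma> s \<in> U \<and> transverse (\<phi> (\<gamma> s)) = transverse (\<phi> (\<gamma> t))"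
    using path_stays_in_plaque [OF U(1) \<gamma> _ U(2)] t by auto
  obtain \<delta> where \<delta>: "0 < \<delta>" "\<delta> < \<epsilon>" "\<delta> < t" "\<delta> < 1 - t"
    using \<epsilon>(1) t field_lbound_gt_zero [of "min \<epsilon> t" "1 - t"] by auto
  define a b f where "a = t - \<delta>" "b = t + \<delta>" "f = (\<lambda>s. \<phi> (\<gamma> s) 0)"
  have ab: "0 < a" "a < t" "t < b" "b < 1"
    using \<delta> by (auto simp: a_b_f_def)
  have in_plaque: "\<gamma> s \<in> U" "transverse (\<phi> (\<gamma> s)) = transverse (\<phi> (\<gamma> t))" if "s \<in> {a..b}" for s
    using \<epsilon>(2) [of s] that \<delta> by (auto simp: a_b_f_def)
  have contf: "continuous_on {a..b} f"
    unfolding a_b_f_def(3) using ab in_plaque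
    by (intro continuous_on_coordinate_path [OF U(1) \<gamma>]) auto
  \<comment> \<open>On \<open>{a..b}\<close> the path stays in one plaque, where coordinate 0
    determines the point, so \<open>f\<close> inherits injectivity from \<open>\<gamma>\<close>.
    Being continuous as well, it is strictly monotone.\<close>
  have "inj_on f {a..b}"
  proof (rule inj_onI)
    fix r s assume rs: "r \<in> {a..b}" "s \<in> {a..b}" "f r = f s"
    then have "\<gamma> r = \<gamma> s"
      using in_plaque by (intro chart_on_eqI [OF chart]) (auto simp: a_b_f_def(3))
    then show "r = s"
      using inj rs ab by (auto dest: inj_onD)
  qed
  then have mono: "f a < f t \<and> f t < f b \<or> f b < f t \<and> f t < f a"
    using continuous_inj_imp_mono [OF ab(2,3) contf] by blast
  \<comment> \<open>With this radius the interval around \<open>f t\<close> lies between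
    \<open>f a\<close> and \<open>f b\<close>, so \<open>f\<close> attains all its values on
    \<open>{a..b}\<close>.\<close>
  define e where "e = min \<bar>f a - f t\<bar> \<bar>f b - f t\<bar>"
  define T where "T = {q \<in> U. \<phi> q 0 \<in> {f t - e<..<f t + e}}"
  have "openin (subtopology M U) {q \<in> topspace (subtopology M U). \<phi> q 0 \<in> {f t - e<..<f t + e}}"
    using chart_on_continuous_coordinate [OF chart]
    by (rule openin_continuous_map_preimage) simp
  moreover have "{q \<in> topspace (subtopology M U). \<phi> q 0 \<in> {f t - e<..<f t + e}} = T"
    using openin_subset [OF chart_on_openin [OF chart]] by (auto simp: T_def)
  ultimately have "openin (subtopology M U) T"
    by simp
  then have "openin M T" "T \<subseteq> U"
    using chart_on_openin [OF chart] openin_trans_full by (auto simp: T_def)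
  then have "openin L {q \<in> T. transverse (\<phi> q) = transverse (\<phi> (\<gamma> t))}"
    by (rule openin_leaf_topology_slice [OF U(1)])
  moreover have "0 < e"
    using mono by (auto simp: e_def)
  then have "\<gamma> t \<in> {q \<in> T. transverse (\<phi> q) = transverse (\<phi> (\<gamma> t))}"
    using U by (auto simp: T_def a_b_f_def(3))
  moreover have "{q \<in> T. transverse (\<phi> q) = transverse (\<phi> (\<gamma> t))} \<subseteq> \<gamma> ` {0<..<1}"
  proof
    fix q assume q: "q \<in> {q \<in> T. transverse (\<phi> q) = transverse (\<phi> (\<gamma> t))}"
    then have "f a \<le> \<phi> q 0 \<and> \<phi> q 0 \<le> f b \<or> f b \<le> \<phi> q 0 \<and> \<phi> q 0 \<le> f a"
      using mono unfolding T_def e_def by auto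
    then obtain s where s: "s \<in> {a..b}" "f s = \<phi> q 0"
      using IVT' [of f a "\<phi> q 0" b] IVT2' [of f b "\<phi> q 0" a] contf ab by fastforce
    have "q = \<gamma> s"
      using q s in_plaque by (intro chart_on_eqI [OF chart]) (auto simp: T_def a_b_f_def(3))
    then show "q \<in> \<gamma> ` {0<..<1}"
      using s ab by auto
  qed
  ultimately show "\<exists>S. openin L S \<and> x \<in> S \<and> S \<subseteq> \<gamma> ` {0<..<1}"
    using t(3) by blast
qed

text \<open>Both paths begin in the plaque of \<open>p\<close> and move coordinate 0 to the same
  side, so by the intermediate value theorem they attain a common value beyond that of
  \<open>p\<close>. Within one plaque this is a common point.\<close>

lemma arcs_in_same_direction_meet:
  assumes U: "(U, \<phi>) \<in> \<A>" "p \<in> U"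
    and \<gamma>: "pathin L \<gamma>" "\<gamma> 0 = p" "starts_in_direction U \<phi> d \<gamma>"
    and \<gamma>': "pathin L \<gamma>'" "\<gamma>' 0 = p" "starts_in_direction U \<phi> d \<gamma>'"
  obtains t where "0 < t" "t < 1" "\<gamma> t \<in> \<gamma>' ` {0..1}"
proof -
  \<comment> \<open>Up to time \<open>r\<close> both paths remain in the plaque of \<open>p\<close>,
    and at time \<open>r\<close> both have moved in direction \<open>d\<close>.\<close>
  obtain r where r: "0 < r" "r < 1" and
    in_plaque: "\<And>s. s \<in> {0..r} \<Longrightarrow> \<gamma> s \<in> U \<and> transverse (\<phi> (\<gamma> s)) = transverse (\<phi> p)"
      "\<And>s. s \<in> {0..r} \<Longrightarrow> \<gamma>' s \<in> U \<and> transverse (\<phi> (\<gamma>' s)) = transverse (\<phi> p)"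
    and dir: "d * \<phi> p 0 < d * \<phi> (\<gamma> r) 0" "d * \<phi> p 0 < d * \<phi> (\<gamma>' r) 0"
  proof -
    obtain e1 where e1: "0 < e1" "\<And>s. \<lbrakk>s \<in> {0..1}; \<bar>s - 0\<bar> < e1\<rbrakk> \<Longrightarrow>
        \<gamma> s \<in> U \<and> transverse (\<phi> (\<gamma> s)) = transverse (\<phi> (\<gamma> 0))"
      using path_stays_in_plaque [OF U(1) \<gamma>(1), of 0] U \<gamma>(2) by auto
    obtain e2 where e2: "0 < e2" "\<And>s. \<lbrakk>s \<in> {0..1}; \<bar>s - 0\<bar> < e2\<rbrakk> \<Longrightarrow>
        \<gamma>' s \<in> U \<and> transverse (\<phi> (\<gamma>' s)) = transverse (\<phi> (\<gamma>' 0))"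
      using path_stays_in_plaque [OF U(1) \<gamma>'(1), of 0] U \<gamma>'(2) by auto
    obtain e3 where e3: "0 < e3" "e3 \<le> 1" "\<And>s. \<lbrakk>0 < s; s < e3\<rbrakk> \<Longrightarrow> d * (\<phi> (\<gamma> s) 0 - \<phi> (\<gamma> 0) 0) > 0"
      using \<gamma>(3) unfolding starts_in_direction_def by blast
    obtain e4 where e4: "0 < e4" "e4 \<le> 1" "\<And>s. \<lbrakk>0 < s; s < e4\<rbrakk> \<Longrightarrow> d * (\<phi> (\<gamma>' s) 0 - \<phi> (\<gamma>' 0) 0) > 0"
      using \<gamma>'(3) unfolding starts_in_direction_def by blast
    obtain r where r: "0 < r" "r < e1" "r < e2" "r < e3" "r < e4"
      using e1(1) e2(1) e3(1) e4(1) field_lbound_gt_zero [of "min e1 e2" "min e3 e4"] by auto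
    show ?thesis
      using that [of r] r e1(2) e2(2) e3(2,3) e4(3) \<gamma>(2) \<gamma>'(2) by (auto simp: algebra_simps)
  qed
  \<comment> \<open>The factor \<open>d\<close> turns the chosen direction into that of larger
    values.\<close>
  define f where "f = (\<lambda>\<gamma> s. d * \<phi> ((\<gamma> :: real \<Rightarrow> 'a) s) 0)"
  have cont: "continuous_on {0..r} (f \<gamma>)" "continuous_on {0..r} (f \<gamma>')"
    unfolding f_def using in_plaque r \<gamma>(1) \<gamma>'(1)
    by (auto intro!: continuous_on_mult_left continuous_on_coordinate_path [OF U(1)])
  \<comment> \<open>The smaller of the two values at \<open>r\<close> still exceeds the common
    starting value. So both paths attain it, and not at time 0.\<close>
  define v where "v = min (f \<gamma> r) (f \<gamma>' r)"
  obtain t where t: "0 \<le> t" "t \<le> r" "f \<gamma> t = v"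
    using IVT' [of "f \<gamma>" 0 v r] cont(1) r dir by (auto simp: f_def v_def \<gamma>(2))
  obtain s where s: "0 \<le> s" "s \<le> r" "f \<gamma>' s = v"
    using IVT' [of "f \<gamma>'" 0 v r] cont(2) r dir by (auto simp: f_def v_def \<gamma>'(2))
  have "d \<noteq> 0"
    using dir by auto
  with t(3) s(3) have "\<phi> (\<gamma> t) 0 = \<phi> (\<gamma>' s) 0"
    by (auto simp: f_def)
  then have "\<gamma> t = \<gamma>' s"
    using in_plaque t s by (intro chart_on_eqI [OF atlas_chart [OF U(1)]]) auto
  moreover have "t \<noteq> 0"
    using t(3) dir \<gamma>(2) by (auto simp: f_def v_def)
  ultimately show ?thesis
    using that [of t] t s r by auto
qed

text \<open>The parameters in \<open>{0<..<1}\<close> at which \<open>\<gamma>\<close> lies on the other arc form a closed set; it is open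
  as well, because there \<open>\<gamma>\<close> meets neither endpoint of that arc.\<close>

lemma arc_subset_arc:
  assumes U: "(U, \<phi>) \<in> \<A>" "p \<in> U"
    and \<gamma>: "pathin L \<gamma>" "\<gamma> 0 = p" "starts_in_direction U \<phi> d \<gamma>" "inj_on \<gamma> {0..1}"
    and \<gamma>': "pathin L \<gamma>'" "\<gamma>' 0 = p" "starts_in_direction U \<phi> d \<gamma>'" "inj_on \<gamma>' {0..1}"
    and outside: "\<gamma>' 1 \<notin> \<gamma> ` {0..1}"
  shows "\<gamma> ` {0..1} \<subseteq> \<gamma>' ` {0..1}"
proof -
  define T where "T = {t \<in> {0..1}. \<gamma> t \<in> \<gamma>' ` {0..1}}"
  have "closedin L (\<gamma>' ` {0..1})"
    using compactin_path_image [OF \<gamma>'(1)] Hausdorff_space_leaf_topology compactin_imp_closedin by blast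
  then have "closedin (top_of_set {0..1}) {t \<in> topspace (top_of_set {0..1}). \<gamma> t \<in> \<gamma>' ` {0..1}}"
    using closedin_continuous_map_preimage [OF \<gamma>(1) [unfolded pathin_def]] by blast
  then have closT: "closed T"
    by (simp add: T_def closedin_closed_eq)
  have "openin (top_of_set {0..1}) {t \<in> topspace (top_of_set {0..1}). \<gamma> t \<in> \<gamma>' ` {0<..<1}}"
    using \<gamma>(1) openin_leaf_topology_arc_interior [OF \<gamma>'(1,4)] unfolding pathin_def
    by (rule openin_continuous_map_preimage)
  then obtain Q where Q: "open Q" "{t \<in> {0..1}. \<gamma> t \<in> \<gamma>' ` {0<..<1}} = {0..1} \<inter> Q"
    by (auto simp: openin_open)
  have "\<gamma> t \<in> \<gamma>' ` {0<..<1}" if "t \<in> {0<..<1}" "t \<in> T" for t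
  proof -
    obtain s where s: "s \<in> {0..1}" "\<gamma> t = \<gamma>' s"
      using \<open>t \<in> T\<close> by (auto simp: T_def)
    \<comment> \<open>Injectivity of \<open>\<gamma>\<close> excludes the common starting point
      \<open>p\<close>; the other endpoint is excluded by \<open>outside\<close>.\<close>
    have "\<gamma> t \<noteq> \<gamma> 0"
      using \<gamma>(4) \<open>t \<in> {0<..<1}\<close> by (auto dest!: inj_onD)
    then have "s \<noteq> 0"
      using s(2) \<gamma>(2) \<gamma>'(2) by auto
    moreover have "s \<noteq> 1"
      using s(2) outside \<open>t \<in> {0<..<1}\<close> by (metis atLeastAtMost_iff greaterThanLessThan_iff image_eqI less_imp_le)
    ultimately show ?thesis
      using s by auto
  qed
  then have "{0<..<1} \<inter> T = {0<..<1} \<inter> Q"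
    using Q(2) by (fastforce simp: T_def)
  then have "openin (top_of_set {0<..<1}) ({0<..<1} \<inter> T)" "closedin (top_of_set {0<..<1}) ({0<..<1} \<inter> T)"
    using Q(1) closT by (auto simp: openin_open closedin_closed)
  \<comment> \<open>The common direction \<open>d\<close> is what makes the clopen set
    nonempty.\<close>
  moreover have "{0<..<1} \<inter> T \<noteq> {}"
  proof -
    obtain t where "0 < t" "t < 1" "\<gamma> t \<in> \<gamma>' ` {0..1}"
      by (rule arcs_in_same_direction_meet [OF U \<gamma>(1-3) \<gamma>'(1-3)])
    then have "t \<in> {0<..<1} \<inter> T"
      by (simp add: T_def)
    then show ?thesis
      by blast
  qed
  ultimately have "{0<..<1} \<inter> T = {0<..<1}"
    using connected_clopen [THEN iffD1, OF connected_Ioo [of 0 "1::real"]] by blast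
  \<comment> \<open>Connectedness covers the open interval; closedness of \<open>T\<close> adds the
    parameters 0 and 1.\<close>
  then have "closure {0<..<1} \<subseteq> T"
    using closT by (metis closure_minimal inf_le2)
  then show ?thesis
    by (auto simp: T_def)
qed

section \<open>Countable subsets of long semi-leaves\<close>

text \<open>The counterpart of the boundedness of countable subsets of the long ray, obtained
  without a homeomorphism to that ray. Non-metrizability yields an arc reaching beyond all the arcs
  to points of \<open>C\<close>.\<close>

lemma countable_subset_of_long_semi_leaf_in_arc:
  assumes "long_semi_leaf M \<A> S" "countable C" "C \<subseteq> S"
  shows "\<exists>K. compactin L K \<and> C \<subseteq> K"
proof -
  obtain p U \<phi> d where U: "(U, \<phi>) \<in> \<A>" "p \<in> U" and S: "S = semi_leaf M \<A> p U \<phi> d"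
    using assms(1) unfolding long_semi_leaf_def is_semi_leaf_def by blast
  \<comment> \<open>The point \<open>p\<close> is set aside because no injective path leads from
    \<open>p\<close> back to \<open>p\<close>.\<close>
  have "\<forall>q\<in>S - {p}. \<exists>\<gamma>. pathin L \<gamma> \<and> \<gamma> 0 = p \<and> starts_in_direction U \<phi> d \<gamma> \<and> inj_on \<gamma> {0..1} \<and> \<gamma> 1 = q"
    unfolding S semi_leaf_def pathin_subtopology by blast
  from bchoice [OF this] obtain \<gamma> where \<gamma>: "\<And>q. q \<in> S - {p} \<Longrightarrow> pathin L (\<gamma> q)"
    "\<And>q. q \<in> S - {p} \<Longrightarrow> \<gamma> q 0 = p" "\<And>q. q \<in> S - {p} \<Longrightarrow> starts_in_direction U \<phi> d (\<gamma> q)"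
    "\<And>q. q \<in> S - {p} \<Longrightarrow> inj_on (\<gamma> q) {0..1}" "\<And>q. q \<in> S - {p} \<Longrightarrow> \<gamma> q 1 = q"
    by blast
  \<comment> \<open>Including \<open>{p}\<close> ensures that a point of \<open>S\<close> outside
    \<open>\<Union>\<K>\<close> differs from \<open>p\<close> and so has a chosen arc.\<close>
  define \<K> where "\<K> = insert {p} ((\<lambda>q. \<gamma> q ` {0..1}) ` (C - {p}))"
  have "p \<in> topspace L"
    using openin_subset [OF chart_on_openin [OF atlas_chart [OF U(1)]]] U(2) topspace_leaf_topology by blast
  then have cptK: "compactin L K" if "K \<in> \<K>" for K
    using that \<gamma>(1) assms(3) compactin_path_image by (auto simp: \<K>_def)
  have "countable \<K>"
    using assms(2) by (simp add: \<K>_def)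
  then have "metrizable_space (subtopology L (\<Union>\<K>))"
    using regular_space_leaf_topology Hausdorff_space_leaf_topology leaf_topology_locally_second_countable cptK
    by (intro metrizable_countable_Union_compact) auto
  moreover have "\<not> metrizable_space (subtopology L S)"
    using assms(1) by (simp add: long_semi_leaf_def)
  \<comment> \<open>Otherwise \<open>S\<close> would be a subspace of a metrizable space.\<close>
  ultimately have "\<not> S \<subseteq> \<Union>\<K>"
    by (metis inf.absorb2 metrizable_space_subtopology subtopology_subtopology)
  then obtain q where q: "q \<in> S - {p}" "\<And>c. c \<in> C - {p} \<Longrightarrow> q \<notin> \<gamma> c ` {0..1}"
    by (auto simp: \<K>_def)
  have "C \<subseteq> \<gamma> q ` {0..1}"
  proof
    fix c assume "c \<in> C"
    show "c \<in> \<gamma> q ` {0..1}"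
    proof (cases "c = p")
      case True
      then show ?thesis
        using \<gamma>(2) [OF q(1)] by force
    next
      case False
      then have c: "c \<in> S - {p}" "c \<in> C - {p}"
        using \<open>c \<in> C\<close> assms(3) by auto
      have "\<gamma> q 1 \<notin> \<gamma> c ` {0..1}"
        using q(2) [OF c(2)] \<gamma>(5) [OF q(1)] by simp
      then have "\<gamma> c ` {0..1} \<subseteq> \<gamma> q ` {0..1}"
        using arc_subset_arc [OF U \<gamma>(1,2,3,4) [OF c(1)] \<gamma>(1,2,3,4) [OF q(1)]] by blast
      moreover have "c \<in> \<gamma> c ` {0..1}"
        using imageI [of 1 "{0..1}" "\<gamma> c"] \<gamma>(5) [OF c(1)] by simp
      ultimately show ?thesis
        by blast
    qed
  qed
  then show ?thesis
    using \<gamma>(1) [OF q(1)] compactin_path_image by blast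
qed

lemma semi_leaf_subset_topspace:
  assumes "is_semi_leaf M \<A> S"
  shows "S \<subseteq> topspace M"
proof -
  obtain p U \<phi> d where U: "(U, \<phi>) \<in> \<A>" "p \<in> U" and S: "S = semi_leaf M \<A> p U \<phi> d"
    using assms unfolding is_semi_leaf_def by blast
  have "p \<in> topspace M"
    using openin_subset [OF chart_on_openin [OF atlas_chart [OF U(1)]]] U(2) by blast
  moreover have "q \<in> topspace M" if "q \<in> S" "q \<noteq> p" for q
    using that pathin_leaf_topology_in_topspace [of _ 1]
    unfolding S semi_leaf_def pathin_subtopology by auto
  ultimately show ?thesis
    by blast
qed

text \<open>The compact sets needed to compare the two topologies are arcs in
  \<open>L\<close>.\<close>

theorem long_semi_leaf_properly_embedded:
  assumes "long_semi_leaf M \<A> S"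
  shows "properly_embedded_in M \<A> S"
  unfolding properly_embedded_in_def
proof (rule subtopology_eq_if_countable_subsets_in_compact)
  show "Hausdorff_space M"
    using manifold by (simp add: manifold_def)
  show "S \<subseteq> topspace M"
    using assms semi_leaf_subset_topspace by (simp add: long_semi_leaf_def)
qed (auto simp: continuous_map_leaf_topology topspace_leaf_topology manifold_first_countable [OF manifold]
    countable_subset_of_long_semi_leaf_in_arc [OF assms])

end

theorem proposition7p1:
  fixes M :: "'a topology" and n :: nat
    and \<A> :: "('a set \<times> ('a \<Rightarrow> nat \<Rightarrow> real)) set"
  assumes "manifold n M"
    and "one_dim_foliation n M \<A>"
  shows "\<forall>S. long_semi_leaf M \<A> S \<longrightarrow> properly_embedded_in M \<A> S"
  using foliated_manifold.long_semi_leaf_properly_embedded [OF foliated_manifold.intro [OF assms]] by blast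

end
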